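(* There is no function $f:\mathbb{N}\to\mathbb{N}$ such that $\operatorname{tw}(G\circ H)\leq f(\operatorname{tw}(G\boxtimes H))$ for all graphs $G$ and $H$.
   Context: All graphs are simple, finite and undirected. A tree-decomposition of a graph $G$ is a pair $(T,\beta)$ consisting of a tree $T$ and a function $\beta:V(T)\to 2^{V(G)}$ such that (i) for every $v\in V(G)$, the set $\{t\in V(T): v\in\beta(t)\}$ is non-empty and induces a connected subgraph of $T$; and (ii) for every edge $uv\in E(G)$ there is $t\in V(T)$ with $\{u,v\}\subseteq\beta(t)$. Its width is $\max_{t\in V(T)}|\beta(t)|-1$. The treewidth $\operatorname{tw}(G)$ is the minimum width of a tree-decomposition of $G$. The strong product $G\boxtimes H$ is the graph with vertex set $V(G)\times V(H)$, where $(g_1,h_1)(g_2,h_2)$ is an edge if and only if $g_1=g_2$ and $h_1h_2\in E(H)$; or $g_1g_2\in E(G)$ and $h_1=h_2$; or $g_1g_2\in E(G)$ and $h_1h_2\in E(H)$. The lexicographic product $G\circ H$ is the graph with vertex set $V(G)\times V(H)$, where $(g_1,h_1)(g_2,h_2)$ is an edge if and only if $g_1g_2\in E(G)$; or $g_1=g_2$ and $h_1h_2\in E(H)$. *)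

theory Defs
  imports "Graph_Theory.Graph_Theory"
begin

text \<open>
  A finite simple undirected graph is a \<^locale>\<open>pair_graph\<close>: a finite, loop-free, symmetric
  relation on a finite vertex set, where the edge \<open>uv\<close> is represented by both arcs \<open>(u, v)\<close> and
  \<open>(v, u)\<close>.
\<close>

definition strong_product ::
    "'a pair_pre_digraph \<Rightarrow> 'b pair_pre_digraph \<Rightarrow> ('a \<times> 'b) pair_pre_digraph" where
  "strong_product G H =
    \<lparr> pverts = pverts G \<times> pverts H,
      parcs = {((g1, h1), (g2, h2)) | g1 h1 g2 h2.
        (g1, h1) \<in> pverts G \<times> pverts H \<and> (g2, h2) \<in> pverts G \<times> pverts H \<and>
        (g1 = g2 \<and> (h1, h2) \<in> parcs H \<or>
         (g1, g2) \<in> parcs G \<and> h1 = h2 \<or>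
         (g1, g2) \<in> parcs G \<and> (h1, h2) \<in> parcs H)} \<rparr>"

definition lexicographic_product ::
    "'a pair_pre_digraph \<Rightarrow> 'b pair_pre_digraph \<Rightarrow> ('a \<times> 'b) pair_pre_digraph" where
  "lexicographic_product G H =
    \<lparr> pverts = pverts G \<times> pverts H,
      parcs = {((g1, h1), (g2, h2)) | g1 h1 g2 h2.
        (g1, h1) \<in> pverts G \<times> pverts H \<and> (g2, h2) \<in> pverts G \<times> pverts H \<and>
        ((g1, g2) \<in> parcs G \<or>
         g1 = g2 \<and> (h1, h2) \<in> parcs H)} \<rparr>"

text \<open>
  The library predicate \<^const>\<open>tree\<close> cannot be used on symmetric digraphs: the two arcs of an
  edge form a directed cycle of length 2 there. In a symmetric loop-free digraph the cycles of the
  underlying undirected graph are exactly the directed cycles of length at least 3.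
\<close>

definition undirected_tree :: "'t pair_pre_digraph \<Rightarrow> bool" where
  "undirected_tree T \<longleftrightarrow> pair_graph T \<and> connected (with_proj T) \<and>
    \<not> (\<exists>p. pre_digraph.cycle (with_proj T) p \<and> length p \<ge> 3)"

text \<open>
  The library predicate \<^const>\<open>connected\<close> is false for the graph without vertices. Hence a tree has
  at least one node, and the first condition on \<open>v\<close> below includes that the set of nodes whose bag
  contains \<open>v\<close> is non-empty.
\<close>

definition tree_decomposition ::
    "'a pair_pre_digraph \<Rightarrow> 't pair_pre_digraph \<Rightarrow> ('t \<Rightarrow> 'a set) \<Rightarrow> bool" where
  "tree_decomposition G T \<beta> \<longleftrightarrow>
    undirected_tree T \<and>
    (\<forall>t \<in> pverts T. \<beta> t \<subseteq> pverts G) \<and>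
    (\<forall>v \<in> pverts G. {t \<in> pverts T. v \<in> \<beta> t} \<noteq> {} \<and>
      connected (with_proj T \<restriction> {t \<in> pverts T. v \<in> \<beta> t})) \<and>
    (\<forall>(u, v) \<in> parcs G. \<exists>t \<in> pverts T. {u, v} \<subseteq> \<beta> t)"

text \<open>
  The subtraction on \<^typ>\<open>nat\<close> truncates only if all bags are empty, that is, only for the graph
  without vertices, which thereby gets treewidth 0.
\<close>

definition decomposition_width :: "'t pair_pre_digraph \<Rightarrow> ('t \<Rightarrow> 'a set) \<Rightarrow> nat" where
  "decomposition_width T \<beta> = Max ((\<lambda>t. card (\<beta> t)) ` pverts T) - 1"

text \<open>
  Trees are finite, so up to isomorphism their nodes are natural numbers.
\<close>

definition treewidth :: "'a pair_pre_digraph \<Rightarrow> nat" where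
  "treewidth G = (LEAST k. \<exists>(T :: nat pair_pre_digraph) \<beta>.
    tree_decomposition G T \<beta> \<and> decomposition_width T \<beta> = k)"

lemma pair_graph_strong_product:
  assumes "pair_graph G" "pair_graph H"
  shows "pair_graph (strong_product G H)"
proof -
  interpret G: pair_graph G by fact
  interpret H: pair_graph H by fact
  have "finite (parcs (strong_product G H))"
    by (rule finite_subset[of _ "(pverts G \<times> pverts H) \<times> (pverts G \<times> pverts H)"])
       (auto simp: strong_product_def)
  moreover have "sym (parcs G)" "sym (parcs H)"
    using G.sym_arcs H.sym_arcs by (auto simp: symmetric_def)
  ultimately show ?thesis
    by unfold_locales
       (auto simp: strong_product_def symmetric_def sym_def dest: G.no_loops H.no_loops)
qed

lemma pair_graph_lexicographic_product:
  assumes "pair_graph G" "pair_graph H"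
  shows "pair_graph (lexicographic_product G H)"
proof -
  interpret G: pair_graph G by fact
  interpret H: pair_graph H by fact
  have "finite (parcs (lexicographic_product G H))"
    by (rule finite_subset[of _ "(pverts G \<times> pverts H) \<times> (pverts G \<times> pverts H)"])
       (auto simp: lexicographic_product_def)
  moreover have "sym (parcs G)" "sym (parcs H)"
    using G.sym_arcs H.sym_arcs by (auto simp: symmetric_def)
  ultimately show ?thesis
    by unfold_locales
       (auto simp: lexicographic_product_def symmetric_def sym_def dest: G.no_loops H.no_loops)
qed

lemma single_node_tree: "undirected_tree \<lparr> pverts = {t}, parcs = {} \<rparr>"
proof -
  interpret pair_graph "\<lparr> pverts = {t}, parcs = {} \<rparr>"
    by unfold_locales (auto simp: symmetric_def sym_def)
  have "\<not> cycle p" for p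
    by (cases p) (auto simp: cycle_def awalk_def)
  moreover have "connected (with_proj \<lparr> pverts = {t}, parcs = {} \<rparr>)"
    by (auto simp: connected_def strongly_connected_def mk_symmetric_def reachable_def)
  ultimately show ?thesis
    using pair_graph by (auto simp: undirected_tree_def)
qed

lemma treewidth_attained:
  assumes "pair_graph G"
  shows "\<exists>(T :: nat pair_pre_digraph) \<beta>.
    tree_decomposition G T \<beta> \<and> decomposition_width T \<beta> = treewidth G"
proof -
  interpret pair_graph G by fact
  let ?T = "\<lparr> pverts = {0 :: nat}, parcs = {} \<rparr>"
  have "connected (with_proj ?T \<restriction> {0})"
    by (auto simp: connected_def strongly_connected_def mk_symmetric_def reachable_def)
  then have "tree_decomposition G ?T (\<lambda>_. pverts G)"
    using single_node_tree[of "0 :: nat"] in_arcsD1 in_arcsD2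
    by (auto simp: tree_decomposition_def)
  then have "\<exists>k (T :: nat pair_pre_digraph) \<beta>.
      tree_decomposition G T \<beta> \<and> decomposition_width T \<beta> = k"
    by blast
  then show ?thesis
    unfolding treewidth_def by (rule LeastI_ex)
qed

end

theory Submission
  imports Defs
begin

text \<open>
  Take \<open>G = K\<^sub>2\<close> and let \<open>H\<close> consist of \<open>n\<close> isolated vertices. The strong product is a matching
  with \<open>n\<close> edges, of treewidth at most 1, while the lexicographic product is \<open>K\<^sub>n\<^sub>,\<^sub>n\<close>. In a
  tree-decomposition of \<open>K\<^sub>n\<^sub>,\<^sub>n\<close> the subtrees of the vertices on one side all meet those of the
  vertices on the other side. Repeatedly deleting leaves of the tree keeps this property until some
  subtree is a single node; the bag of that node contains the whole opposite side, so the treewidth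
  is at least \<open>n - 1\<close>.
\<close>

section \<open>Low-degree vertices of forests\<close>

lemma walk_of_vertex_list:
  assumes "xs \<noteq> []" "successively (\<lambda>x y. (x, y) \<in> E) xs"
  shows "pcas (hd xs) (zip xs (tl xs)) (last xs)"
    and "pawalk_verts (hd xs) (zip xs (tl xs)) = xs"
    and "set (zip xs (tl xs)) \<subseteq> E"
  using assms by (induction xs rule: induct_list012) auto

text \<open>The closing arc comes first: the walk starts at \<open>last xs\<close>, so the tail of
  its vertex sequence is \<open>xs\<close> itself and \<open>distinct xs\<close> is the condition in
  \<open>cycle\<close>. The length is recorded because a two-vertex list yields only an edge
  traversed back and forth.\<close>

lemma cycle_of_vertex_list:
  assumes "pair_wf_digraph T" "xs \<noteq> []" "distinct xs"
    "successively (\<lambda>x y. (x, y) \<in> parcs T) (last xs # xs)"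
  shows "\<exists>p. pre_digraph.cycle (with_proj T) p \<and> length p = length xs"
proof -
  interpret pair_wf_digraph T by fact
  let ?p = "zip (last xs # xs) xs"
  have "pcas (last xs) ?p (last xs)" "pawalk_verts (last xs) ?p = last xs # xs"
    "set ?p \<subseteq> parcs T"
    using walk_of_vertex_list[OF _ assms(4)] \<open>xs \<noteq> []\<close> by auto
  moreover have "last xs \<in> pverts T"
    using assms(2,4) in_arcsD1 by (cases xs) auto
  ultimately have "cycle ?p"
    unfolding cycle_def awalk_def using assms(2,3) by (intro exI[of _ "last xs"]) (cases xs; simp)
  then show ?thesis by (intro exI[of _ ?p]) simp
qed

text \<open>Longest-path argument: if every vertex of \<open>V\<close> had two neighbours in
  \<open>V\<close>, the first vertex of a longest path would have a neighbour further along that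
  path, closing a cycle. Isolated vertices count as leaves, so the forest on \<open>V\<close> may be
  disconnected.\<close>

lemma acyclic_obtains_leaf:
  assumes "pair_graph T" "\<not> (\<exists>p. pre_digraph.cycle (with_proj T) p \<and> length p \<ge> 3)"
    and "finite V" "V \<noteq> {}"
  obtains l where "l \<in> V"
    "\<And>p q. p \<in> V \<Longrightarrow> q \<in> V \<Longrightarrow> (l, p) \<in> parcs T \<Longrightarrow> (l, q) \<in> parcs T \<Longrightarrow> p = q"
proof (rule ccontr)
  interpret pair_graph T by fact
  assume "\<not> thesis"
  with that have two: "\<exists>p q. p \<in> V \<and> q \<in> V \<and> (l, p) \<in> parcs T \<and> (l, q) \<in> parcs T \<and> p \<noteq> q"
    if "l \<in> V" for l
    using \<open>l \<in> V\<close> by blast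
  define path where "path xs \<longleftrightarrow> xs \<noteq> [] \<and> distinct xs \<and> set xs \<subseteq> V \<and>
    successively (\<lambda>x y. (x, y) \<in> parcs T) xs" for xs
  obtain a where "a \<in> V" using \<open>V \<noteq> {}\<close> by blast
  then have "path [a]" by (simp add: path_def)
  moreover have "length xs < Suc (card V)" if "path xs" for xs
    using that \<open>finite V\<close> card_mono[of V "set xs"] by (simp add: path_def distinct_card)
  ultimately obtain xs where "path xs" and max: "\<And>ys. path ys \<Longrightarrow> length ys \<le> length xs"
    using ex_has_greatest_nat[of path "[a]" length "Suc (card V)"] by (metis less_imp_le)
  then obtain v zs where xs: "xs = v # zs" by (cases xs) (auto simp: path_def)
  with \<open>path xs\<close> have "v \<in> V" by (simp add: path_def)
  then obtain w where w: "w \<in> V" "(v, w) \<in> parcs T" "zs \<noteq> [] \<Longrightarrow> w \<noteq> hd zs"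
    using two by metis
  then have wv: "(w, v) \<in> parcs T" "w \<noteq> v" using arcs_symmetric no_loops' by auto
  \<comment> \<open>Prepending \<open>w\<close> would beat the maximal length, so \<open>w\<close>
    already lies on the path.\<close>
  have "\<not> path (w # xs)" using max[of "w # xs"] by auto
  then have "w \<in> set zs" using \<open>path xs\<close> w wv by (auto simp: path_def xs)
  then obtain as bs where zs: "zs = as @ w # bs" by (meson split_list)
  \<comment> \<open>As \<open>w\<close> is not the successor of \<open>v\<close>, the cycle through
    \<open>v\<close>, \<open>as\<close> and \<open>w\<close> has at least three vertices.\<close>
  with w(3) have "as \<noteq> []" by auto
  have "distinct (v # as @ [w])" "successively (\<lambda>x y. (x, y) \<in> parcs T) (w # v # as @ [w])"
    using \<open>path xs\<close> wv by (auto simp: path_def xs zs successively_append_iff successively_Cons hd_append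
        split: if_splits)
  with cycle_of_vertex_list[of T "v # as @ [w]"] obtain p
    where "cycle p" "length p = length (v # as @ [w])"
    using pair_wf_digraph by auto
  moreover have "length (v # as @ [w]) \<ge> 3" using \<open>as \<noteq> []\<close> by (cases as) auto
  ultimately show False using assms(2) by metis
qed

section \<open>Subtrees pairwise meeting across two families\<close>

text \<open>Symmetrising adds no arcs here, and \<open>rtrancl_on S\<close> visits only vertices of
  \<open>S\<close>. Deleting nodes then changes only \<open>S\<close>, while the arc set stays that
  of \<open>T\<close>.\<close>

lemma connected_induce_iff:
  assumes "sym (parcs T)"
  shows "connected (with_proj T \<restriction> S) \<longleftrightarrow>
    S \<noteq> {} \<and> (\<forall>u \<in> S. \<forall>v \<in> S. (u, v) \<in> rtrancl_on S (parcs T))"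
proof -
  let ?E = "parcs (mk_symmetric (with_proj T \<restriction> S))"
  have E: "?E = {(u, v) \<in> parcs T. u \<in> S \<and> v \<in> S}"
    using assms by (auto simp: parcs_mk_symmetric dest: symD)
  have "(u, v) \<in> rtrancl_on S ?E \<longleftrightarrow> (u, v) \<in> rtrancl_on S (parcs T)" for u v
  proof
    show "(u, v) \<in> rtrancl_on S (parcs T)" if "(u, v) \<in> rtrancl_on S ?E"
      using that by (induction rule: rtrancl_on_induct) (auto simp: E intro: rtrancl_on_into_rtrancl_on)
    show "(u, v) \<in> rtrancl_on S ?E" if "(u, v) \<in> rtrancl_on S (parcs T)"
      using that by (induction rule: rtrancl_on_induct) (auto simp: E intro: rtrancl_on_into_rtrancl_on)
  qed
  then show ?thesis
    by (simp add: connected_def strongly_connected_def reachable_def)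
qed

text \<open>A walk through \<open>l\<close> enters and leaves it by the same neighbour, so the
  detour can be cut out.\<close>

lemma rtrancl_on_delete_leaf:
  assumes "(u, v) \<in> rtrancl_on S E" "u \<noteq> l" "v \<noteq> l" "sym E"
    and leaf: "\<And>p q. p \<in> S \<Longrightarrow> q \<in> S \<Longrightarrow> (l, p) \<in> E \<Longrightarrow> (l, q) \<in> E \<Longrightarrow> p = q"
  shows "(u, v) \<in> rtrancl_on (S - {l}) E"
proof -
  \<comment> \<open>The invariant for the induction along the walk: while the walk sits at
    \<open>l\<close>, it remembers the neighbour \<open>p\<close> from which it came.\<close>
  have "if v = l then \<exists>p \<in> S. (p, l) \<in> E \<and> (u, p) \<in> rtrancl_on (S - {l}) E
    else (u, v) \<in> rtrancl_on (S - {l}) E"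
    using assms(1)
  proof (induction rule: rtrancl_on_induct)
    case base
    then show ?case using \<open>u \<noteq> l\<close> by auto
  next
    case (step y z)
    show ?case
    proof (cases "y = l")
      case True
      with step obtain p where p: "p \<in> S" "(p, l) \<in> E" "(u, p) \<in> rtrancl_on (S - {l}) E" by auto
      with leaf[of p z] step True \<open>sym E\<close> have "p = z" by (auto dest: symD)
      with p show ?thesis by (auto dest: in_rtrancl_on_in_F)
    next
      case False
      with step show ?thesis by (auto intro: rtrancl_on_into_rtrancl_on)
    qed
  qed
  with \<open>v \<noteq> l\<close> show ?thesis by simp
qed

text \<open>Induction on the number of available nodes, deleting a leaf from \<open>V\<close> and
  from all sets \<open>S v\<close> at once. The alternative in the conclusion reflects which side
  owns the subtree that first shrinks to a single node.\<close>

lemma crossing_subtrees_common_node: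
  assumes T: "pair_graph T" "\<not> (\<exists>p. pre_digraph.cycle (with_proj T) p \<and> length p \<ge> 3)"
    and "finite V" "A \<noteq> {}"
    and "\<And>v. v \<in> A \<union> B \<Longrightarrow> S v \<subseteq> V"
    and "\<And>v x y. v \<in> A \<union> B \<Longrightarrow> x \<in> S v \<Longrightarrow> y \<in> S v \<Longrightarrow> (x, y) \<in> rtrancl_on (S v) (parcs T)"
    and "\<And>v. v \<in> A \<union> B \<Longrightarrow> S v \<noteq> {}"
    and "\<And>a b. a \<in> A \<Longrightarrow> b \<in> B \<Longrightarrow> S a \<inter> S b \<noteq> {}"
  shows "\<exists>t \<in> V. (\<forall>a \<in> A. t \<in> S a) \<or> (\<forall>b \<in> B. t \<in> S b)"
  using assms(3-)
proof (induction "card V" arbitrary: V S)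
  case 0
  \<comment> \<open>With no nodes left, the subtree of an element of \<open>A\<close> would be
    empty.\<close>
  then show ?case by (metis UnCI card_0_eq equals0I subset_empty)
next
  case (Suc n)
  interpret pair_graph T by fact
  have sym: "sym (parcs T)" using sym_arcs by (simp add: symmetric_def)
  have "V \<noteq> {}" using Suc.hyps(2) by auto
  with T \<open>finite V\<close> obtain l where "l \<in> V" and leaf:
    "\<And>p q. p \<in> V \<Longrightarrow> q \<in> V \<Longrightarrow> (l, p) \<in> parcs T \<Longrightarrow> (l, q) \<in> parcs T \<Longrightarrow> p = q"
    using acyclic_obtains_leaf by metis
  show ?case
  proof (cases "\<exists>v \<in> A \<union> B. S v = {l}")
    case True
    \<comment> \<open>Every subtree of the opposite family meets \<open>{l}\<close>, hence contains
      \<open>l\<close>.\<close>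
    then have "(\<forall>a \<in> A. l \<in> S a) \<or> (\<forall>b \<in> B. l \<in> S b)" using Suc.prems(6) by fastforce
    with \<open>l \<in> V\<close> show ?thesis by blast
  next
    case False
    have nbr: "\<exists>p. p \<in> S v \<and> p \<noteq> l \<and> (l, p) \<in> parcs T" if "v \<in> A \<union> B" "l \<in> S v" for v
    proof -
      have "S v \<noteq> {l}" using False that(1) by blast
      with that(2) obtain x where x: "x \<in> S v" "x \<noteq> l" by blast
      have "(l, x) \<in> rtrancl_on (S v) (parcs T)" by (rule Suc.prems(4)[OF that x(1)])
      with x(2) obtain p where "(l, p) \<in> parcs T" "(p, x) \<in> rtrancl_on (S v) (parcs T)"
        by (metis converse_rtrancl_on_cases)
      then show ?thesis using no_loops' in_rtrancl_on_in_F(1) by metis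
    qed
    have "\<exists>t \<in> V - {l}. (\<forall>a \<in> A. t \<in> S a - {l}) \<or> (\<forall>b \<in> B. t \<in> S b - {l})"
    proof (rule Suc.hyps(1))
      show "n = card (V - {l})" using Suc.hyps(2) \<open>l \<in> V\<close> \<open>finite V\<close> by simp
      show "finite (V - {l})" "A \<noteq> {}" using Suc.prems by auto
      fix v assume v: "v \<in> A \<union> B"
      show "S v - {l} \<subseteq> V - {l}" using Suc.prems(3) v by blast
      show "S v - {l} \<noteq> {}" using False Suc.prems(5) v by blast
      fix x y assume "x \<in> S v - {l}" "y \<in> S v - {l}"
      with v show "(x, y) \<in> rtrancl_on (S v - {l}) (parcs T)"
        by (intro rtrancl_on_delete_leaf sym Suc.prems(4)[OF v])
          (use leaf Suc.prems(3)[OF v] in blast)+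
    next
      fix a b assume ab: "a \<in> A" "b \<in> B"
      show "(S a - {l}) \<inter> (S b - {l}) \<noteq> {}"
      proof
        assume "(S a - {l}) \<inter> (S b - {l}) = {}"
        with Suc.prems(6)[OF ab] have "l \<in> S a" "l \<in> S b" by auto
        then obtain p q where "p \<in> S a" "p \<noteq> l" "(l, p) \<in> parcs T"
          "q \<in> S b" "q \<noteq> l" "(l, q) \<in> parcs T"
          using nbr ab by (metis UnI1 UnI2)
        \<comment> \<open>Both subtrees continue from \<open>l\<close> to its only neighbour in
          \<open>V\<close>, so they still meet after the deletion.\<close>
        moreover from this leaf[of p q] have "p = q" using Suc.prems(3) ab by blast
        ultimately show False using \<open>(S a - {l}) \<inter> (S b - {l}) = {}\<close> by blast
      qed
    qed
    then show ?thesis by blast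
  qed
qed

text \<open>The nodes whose bags contain a given vertex form its subtree, and each edge between
  \<open>A\<close> and \<open>B\<close> makes two subtrees meet. The common node has a bag
  containing \<open>A\<close> or \<open>B\<close>.\<close>

lemma biclique_width:
  assumes G: "finite (pverts G)" "tree_decomposition G T \<beta>"
    and AB: "A \<subseteq> pverts G" "B \<subseteq> pverts G" "A \<times> B \<subseteq> parcs G"
    and card: "card A \<ge> n" "card B \<ge> n" "n > 0"
  shows "n - 1 \<le> decomposition_width T \<beta>"
proof -
  have T: "pair_graph T" "\<not> (\<exists>p. pre_digraph.cycle (with_proj T) p \<and> length p \<ge> 3)"
    and bags: "\<And>t. t \<in> pverts T \<Longrightarrow> \<beta> t \<subseteq> pverts G"
    and conn: "\<And>v. v \<in> pverts G \<Longrightarrow> connected (with_proj T \<restriction> {t \<in> pverts T. v \<in> \<beta> t})"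
    and edge: "\<And>u v. (u, v) \<in> parcs G \<Longrightarrow> \<exists>t \<in> pverts T. {u, v} \<subseteq> \<beta> t"
    using G(2) by (auto simp: tree_decomposition_def undirected_tree_def)
  interpret pair_graph T by fact
  have sym: "sym (parcs T)" using sym_arcs by (simp add: symmetric_def)
  have "\<exists>t \<in> pverts T. (\<forall>a \<in> A. t \<in> {t \<in> pverts T. a \<in> \<beta> t}) \<or>
      (\<forall>b \<in> B. t \<in> {t \<in> pverts T. b \<in> \<beta> t})"
  proof (rule crossing_subtrees_common_node[OF T])
    show "A \<noteq> {}" using card by auto
    fix v assume "v \<in> A \<union> B"
    with AB conn have c: "connected (with_proj T \<restriction> {t \<in> pverts T. v \<in> \<beta> t})" by blast
    show "{t \<in> pverts T. v \<in> \<beta> t} \<noteq> {}"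
      using c unfolding connected_induce_iff[OF sym] by simp
    show "(x, y) \<in> rtrancl_on {t \<in> pverts T. v \<in> \<beta> t} (parcs T)"
      if "x \<in> {t \<in> pverts T. v \<in> \<beta> t}" "y \<in> {t \<in> pverts T. v \<in> \<beta> t}" for x y
      using c that unfolding connected_induce_iff[OF sym] by blast
  next
    fix a b assume "a \<in> A" "b \<in> B"
    then show "{t \<in> pverts T. a \<in> \<beta> t} \<inter> {t \<in> pverts T. b \<in> \<beta> t} \<noteq> {}"
      using AB(3) edge[of a b] by blast
  qed auto
  then obtain t where t: "t \<in> pverts T" "A \<subseteq> \<beta> t \<or> B \<subseteq> \<beta> t" by blast
  have "finite (\<beta> t)" using bags[OF t(1)] G(1) finite_subset by blast
  with t(2) card have "n \<le> card (\<beta> t)" by (meson card_mono order_trans)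
  also have "\<dots> \<le> Max ((\<lambda>t. card (\<beta> t)) ` pverts T)" using t(1) by (intro Max_ge) auto
  finally show ?thesis by (simp add: decomposition_width_def)
qed

section \<open>Stars and matchings\<close>

text \<open>The decomposition tree for a matching: each leaf carries one matching edge, and the
  centre 0 only joins the leaves.\<close>

definition star :: "nat \<Rightarrow> nat pair_pre_digraph" where
  "star n = \<lparr> pverts = {0..n}, parcs = {0} \<times> {1..n} \<union> {1..n} \<times> {0} \<rparr>"

lemma pair_graph_star: "pair_graph (star n)"
  by unfold_locales (auto simp: star_def symmetric_def sym_def)

lemma undirected_tree_star: "undirected_tree (star n)"
proof -
  interpret pair_graph "star n" by (rule pair_graph_star)
  have "u \<rightarrow>\<^sup>*\<^bsub>with_proj (star n)\<^esub> 0 \<and> 0 \<rightarrow>\<^sup>*\<^bsub>with_proj (star n)\<^esub> u"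
    if "u \<in> pverts (star n)" for u
  proof (cases "u = 0")
    case False
    with that have "(u, 0) \<in> parcs (star n)" "(0, u) \<in> parcs (star n)"
      by (auto simp: star_def)
    then show ?thesis by blast
  qed (use that in auto)
  moreover have "pverts (star n) \<noteq> {}"
    by (simp add: star_def)
  ultimately have "strongly_connected (with_proj (star n))"
    by (intro strongly_connectedI) (auto intro: reachable_trans)
  then have "connected (with_proj (star n))"
    by (auto simp: connected_def strongly_connected_def intro: reachable_mk_symmetricI)
  moreover have False if "cycle p" "length p \<ge> 3" for p
  proof -
    obtain e1 e2 e3 q where p: "p = e1 # e2 # e3 # q"
      using \<open>length p \<ge> 3\<close> by (metis Suc_le_length_iff numeral_3_eq_3)
    obtain u where "set p \<subseteq> parcs (star n)" "pcas u p u" "distinct (tl (pawalk_verts u p))"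
      using \<open>cycle p\<close> by (auto simp: cycle_def awalk_def)
    moreover have "v \<in> set (pawalk_verts v es)" if "pcas v es w" for v w :: nat and es
      using that
      by (cases es) auto
    \<comment> \<open>Walks in a star alternate between centre and leaves. A closed walk of length 3
      is thus impossible, and a longer one repeats the centre among the vertices after its
      start.\<close>
    ultimately show False
      unfolding p by (cases q) (auto simp: star_def)
  qed
  ultimately show ?thesis
    using pair_graph by (auto simp: undirected_tree_def)
qed

lemma treewidth_matching_le:
  fixes G :: "(nat \<times> nat) pair_pre_digraph"
  assumes "G = \<lparr> pverts = {0, 1} \<times> {1..n},
    parcs = {((i, h), (1 - i, h)) | i h. i \<in> {0, 1} \<and> h \<in> {1..n}} \<rparr>"
  shows "treewidth G \<le> 1"
proof -
  define \<beta> where "\<beta> t = (if t = 0 then {} else {(0 :: nat, t), (1 :: nat, t)})" for t :: nat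
  interpret pair_graph "star n" by (rule pair_graph_star)
  have sym: "sym (parcs (star n))" using sym_arcs by (simp add: symmetric_def)
  \<comment> \<open>Each vertex lies in exactly one bag, so its subtree is a single node.\<close>
  have "{t \<in> pverts (star n). v \<in> \<beta> t} = {snd v}" if "v \<in> pverts G" for v
    using that by (auto simp: assms star_def \<beta>_def)
  then have "{t \<in> pverts (star n). v \<in> \<beta> t} \<noteq> {} \<and>
      connected (with_proj (star n) \<restriction> {t \<in> pverts (star n). v \<in> \<beta> t})" if "v \<in> pverts G" for v
    using that by (simp add: connected_induce_iff[OF sym])
  moreover have "\<exists>t \<in> pverts (star n). {u, v} \<subseteq> \<beta> t" if "(u, v) \<in> parcs G" for u v
    using that by (intro bexI[of _ "snd u"]) (auto simp: assms star_def \<beta>_def)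
  moreover have "\<forall>t \<in> pverts (star n). \<beta> t \<subseteq> pverts G"
    by (auto simp: assms star_def \<beta>_def)
  ultimately have dec: "tree_decomposition G (star n) \<beta>"
    unfolding tree_decomposition_def using undirected_tree_star by blast
  moreover have "decomposition_width (star n) \<beta> \<le> 1"
  proof -
    have "Max ((\<lambda>t. card (\<beta> t)) ` pverts (star n)) \<le> 2"
      by (rule Max.boundedI) (auto simp: \<beta>_def star_def)
    then show ?thesis by (simp add: decomposition_width_def)
  qed
  moreover have "treewidth G \<le> decomposition_width (star n) \<beta>"
    unfolding treewidth_def using dec by (intro Least_le) blast
  ultimately show ?thesis by simp
qed

theorem theorem6:
  shows "\<not> (\<exists>f :: nat \<Rightarrow> nat. \<forall>(G :: nat pair_pre_digraph) (H :: nat pair_pre_digraph).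
    pair_graph G \<longrightarrow> pair_graph H \<longrightarrow>
    treewidth (lexicographic_product G H) \<le> f (treewidth (strong_product G H)))"
proof
  assume "\<exists>f :: nat \<Rightarrow> nat. \<forall>(G :: nat pair_pre_digraph) (H :: nat pair_pre_digraph).
    pair_graph G \<longrightarrow> pair_graph H \<longrightarrow>
    treewidth (lexicographic_product G H) \<le> f (treewidth (strong_product G H))"
  then obtain f :: "nat \<Rightarrow> nat" where f: "\<forall>(G :: nat pair_pre_digraph) (H :: nat pair_pre_digraph).
    pair_graph G \<longrightarrow> pair_graph H \<longrightarrow>
    treewidth (lexicographic_product G H) \<le> f (treewidth (strong_product G H))"
    by (rule exE)
  \<comment> \<open>The treewidth of the strong product is only bounded by 1 and \<open>f\<close> is
    arbitrary, so \<open>n - 1\<close> must exceed both \<open>f 0\<close> and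
    \<open>f 1\<close>.\<close>
  define n where "n = max (f 0) (f 1) + 2"
  define G :: "nat pair_pre_digraph" where "G = \<lparr> pverts = {0, 1}, parcs = {(0, 1), (1, 0)} \<rparr>"
  define H :: "nat pair_pre_digraph" where "H = \<lparr> pverts = {1..n}, parcs = {} \<rparr>"
  have G: "pair_graph G"
    by unfold_locales (auto simp: G_def symmetric_def sym_def)
  have H: "pair_graph H"
    by unfold_locales (auto simp: H_def symmetric_def sym_def)
  have "strong_product G H = \<lparr> pverts = {0, 1} \<times> {1..n},
      parcs = {((i, h), (1 - i, h)) | i h. i \<in> {0, 1} \<and> h \<in> {1..n}} \<rparr>"
    by (auto simp: strong_product_def G_def H_def)
  then have "treewidth (strong_product G H) \<le> 1"
    by (rule treewidth_matching_le)
  then have "treewidth (strong_product G H) = 0 \<or> treewidth (strong_product G H) = 1"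
    by linarith
  with f[rule_format, OF G H] have upper: "treewidth (lexicographic_product G H) < n - 1"
    by (auto simp: n_def)
  obtain T :: "nat pair_pre_digraph" and \<beta>
    where dec: "tree_decomposition (lexicographic_product G H) T \<beta>"
      "decomposition_width T \<beta> = treewidth (lexicographic_product G H)"
    using treewidth_attained[OF pair_graph_lexicographic_product[OF G H]] by blast
  \<comment> \<open>The two copies of the vertex set of \<open>H\<close> are the sides of the
    biclique.\<close>
  have "n - 1 \<le> decomposition_width T \<beta>"
    by (rule biclique_width[OF _ dec(1), of "{0} \<times> {1..n}" "{1} \<times> {1..n}"])
       (auto simp: lexicographic_product_def G_def H_def n_def)
  with upper dec(2) show False by simp
qed

end
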